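(* Let $n$ be a positive integer such that $n\ne 2$. Then there exists a finite group $G$ with exactly $n$ relative cyclic subgroup commutativity degrees, i.e. such that the set $\{csd(H,G) \mid H\in L(G)\}$ has cardinality $n$.
   Context: For a finite group $G$, $L(G)$ denotes the set (lattice) of all subgroups of $G$ and $L_1(G)$ the set (poset) of all cyclic subgroups of $G$. For a subgroup $H$ of $G$, the relative cyclic subgroup commutativity degree of $H$ in $G$ is $$csd(H,G)=\frac{1}{|L_1(H)||L_1(G)|}\left|\{(H_1,G_1)\in L_1(H)\times L_1(G) \mid H_1G_1=G_1H_1\}\right|.$$ The number of relative cyclic subgroup commutativity degrees of $G$ is the number of distinct values of $csd(H,G)$ as $H$ ranges over $L(G)$. *)

theory Defs
  imports Complex_Main "HOL-Algebra.Elementary_Groups"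
begin

definition subgroup_lattice :: "('a, 'b) monoid_scheme \<Rightarrow> 'a set set" where
  "subgroup_lattice G = {H. subgroup H G}"

definition cyclic_subgroups :: "('a, 'b) monoid_scheme \<Rightarrow> 'a set set" where
  "cyclic_subgroups G = {H \<in> subgroup_lattice G. cyclic_group (G\<lparr>carrier := H\<rparr>)}"

(* \<open>csd H G\<close> is meant for a subgroup H of a finite group G; cyclic subgroups of H are
   formed in H as a group in its own right, with the operation of G. *)
definition csd :: "'a set \<Rightarrow> ('a, 'b) monoid_scheme \<Rightarrow> real" where
  "csd H G =
     1 / (real (card (cyclic_subgroups (G\<lparr>carrier := H\<rparr>))) * real (card (cyclic_subgroups G))) *
     real (card {(H1, G1). (H1, G1) \<in> cyclic_subgroups (G\<lparr>carrier := H\<rparr>) \<times> cyclic_subgroups G \<and>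
                   H1 <#>\<^bsub>G\<^esub> G1 = G1 <#>\<^bsub>G\<^esub> H1})"

end

theory Submission
  imports Defs "HOL-Algebra.Sylow" "HOL-Algebra.Product_Groups"
begin

text \<open>
  The value \<open>n = 1\<close> is realized by any abelian group and \<open>n = 3\<close> by the symmetric group
  on three letters. Both are members of one family: let \<open>A\<close> be an elementary abelian group of
  order \<open>3\<^sup>k\<close> and let \<open>G\<close> be the generalized dihedral group over \<open>A\<close>, in which every element
  outside \<open>A\<close> (a reflection) is an involution that inverts \<open>A\<close> by conjugation.

  Every element of \<open>G\<close> has order 1, 2 or 3, so the cyclic subgroups are the sets
  \<open>{1, x, inv x}\<close>. Those inside \<open>A\<close> are normal and therefore permute with every subgroup, while
  two distinct subgroups generated by reflections never permute
  (\<open>cyc_permute_iff\<close>): their product would be a group of order four,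
  hence the two reflections would commute, and their product would be an element of \<open>A\<close> of
  order two. Consequently a subgroup \<open>H\<close> of \<open>A\<close> has commutativity degree 1. For any other
  \<open>H\<close>, with \<open>e = card (H \<inter> A)\<close> and \<open>m = 3\<^sup>k\<close>, half of the elements of \<open>H\<close> are reflections;
  so \<open>H\<close> has \<open>(e + 1) / 2 + e\<close> cyclic subgroups and there are \<open>e (m - 1)\<close> pairs that
  do not permute, whence \<open>csd H G = 1 - 4 e (m - 1) / ((3 e + 1) (3 m + 1))\<close>.
  By the theorems of Lagrange and Sylow, \<open>e\<close> runs exactly through the powers \<open>3\<^sup>i\<close> with
  \<open>i \<le> k\<close>. For \<open>k > 0\<close> this value is strictly decreasing in \<open>e\<close> and less than 1, so
  there are \<open>(k + 1) + 1\<close> degrees, and \<open>k = n - 2\<close> realizes every \<open>n \<ge> 3\<close>. For \<open>k = 0\<close> the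
  only degree is 1. With the truncated subtraction of natural numbers \<open>k = n - 2\<close> is also the
  right choice for \<open>n = 1\<close>.
\<close>

section \<open>Cyclic subgroups\<close>

text \<open>
  The cyclic subgroups of a subgroup are parametrized by its elements, with powers taken in
  the ambient group; this removes the restricted records from all later counting.
\<close>

lemma (in group) cyclic_subgroups_of_subgroup:
  assumes H: "subgroup H G"
  shows "cyclic_subgroups (G\<lparr>carrier := H\<rparr>) = (\<lambda>x. range (\<lambda>n::int. x [^] n)) ` H"
proof -
  interpret H: group "G\<lparr>carrier := H\<rparr>"
    using H by (rule subgroup_imp_group)
  have cyc: "cyclic_group (G\<lparr>carrier := K\<rparr>) \<longleftrightarrow> (\<exists>x\<in>K. K = range (\<lambda>n::int. x [^] n))"
    if K: "subgroup K G" for K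
  proof -
    interpret K: group "G\<lparr>carrier := K\<rparr>"
      using K by (rule subgroup_imp_group)
    show ?thesis
      using int_pow_consistent[OF K] by (auto simp: K.cyclic_group)
  qed
  have sub: "subgroup K (G\<lparr>carrier := H\<rparr>) \<longleftrightarrow> subgroup K G \<and> K \<subseteq> H" for K
    using incl_subgroup[OF H] subgroup_incl[OF _ H] subgroup.subset by fastforce
  define P where "P = (\<lambda>x. range (\<lambda>n::int. x [^] n))"
  have member: "K \<in> cyclic_subgroups (G\<lparr>carrier := H\<rparr>) \<longleftrightarrow>
      (subgroup K G \<and> K \<subseteq> H) \<and> (\<exists>x\<in>K. K = P x)" for K
    unfolding P_def using cyc[of K] by (auto simp: cyclic_subgroups_def subgroup_lattice_def sub)
  have "P x \<in> cyclic_subgroups (G\<lparr>carrier := H\<rparr>)" if x: "x \<in> H" for x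
  proof -
    have xG: "x \<in> carrier G"
      using x H subgroup.mem_carrier by metis
    have "P x \<subseteq> H"
      using x subgroup_int_pow_closed[OF H] by (auto simp: P_def)
    moreover have "x \<in> P x"
      using int_pow_1[OF xG] unfolding P_def by (intro range_eqI[of _ _ 1]) simp
    moreover have "subgroup (P x) G"
      using subgroup_of_powers[OF xG] by (simp add: P_def)
    ultimately show ?thesis
      using member by blast
  qed
  moreover have "K \<in> P ` H" if K: "K \<in> cyclic_subgroups (G\<lparr>carrier := H\<rparr>)" for K
  proof -
    obtain x where "K \<subseteq> H" "x \<in> K" "K = P x"
      using K member[of K] by blast
    then show ?thesis
      by (intro image_eqI[of K P x] subsetD[of K H])
  qed
  ultimately have "cyclic_subgroups (G\<lparr>carrier := H\<rparr>) = P ` H"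
    by (intro equalityI subsetI) auto
  then show ?thesis
    by (simp add: P_def)
qed

section \<open>Generalized dihedral groups over groups of exponent three\<close>

text \<open>
  Being generalized dihedral is expressed through squares and products of reflections only. That
  reflections invert \<open>A\<close>, and that \<open>A\<close> is commutative, is then derived. These conditions are
  easily carried along a bijection. The parameter \<open>k = 0\<close> is allowed and gives the group of
  order two.
\<close>
locale exponent3_dihedral = group G for G (structure) +
  fixes A :: "'a set" and k :: nat
  assumes finite_carrier: "finite (carrier G)"
    and subgroup_A: "subgroup A G"
    and card_A: "card A = 3 ^ k"
    and cube: "a \<in> A \<Longrightarrow> a \<otimes> a \<otimes> a = \<one>"
    and reflection_exists: "carrier G - A \<noteq> {}"
    and reflection_square: "t \<in> carrier G - A \<Longrightarrow> t \<otimes> t = \<one>"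
    and reflections_mult: "\<lbrakk>t \<in> carrier G - A; u \<in> carrier G - A\<rbrakk> \<Longrightarrow> t \<otimes> u \<in> A"
begin

lemma A_closed [simp]:
  "a \<in> A \<Longrightarrow> a \<in> carrier G" "\<one> \<in> A"
  "a \<in> A \<Longrightarrow> inv a \<in> A" "\<lbrakk>a \<in> A; b \<in> A\<rbrakk> \<Longrightarrow> a \<otimes> b \<in> A"
  using subgroup_A by (auto simp: subgroup_def)

lemma reflection_inv: "t \<in> carrier G - A \<Longrightarrow> inv t = t"
  using reflection_square inv_equality by blast

lemma reflection_mult_A:
  assumes "t \<in> carrier G - A" "a \<in> A"
  shows "t \<otimes> a \<in> carrier G - A"
proof -
  have "t = (t \<otimes> a) \<otimes> inv a"
    using assms by (simp add: m_assoc)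
  then show ?thesis
    using assms A_closed by (metis DiffD1 DiffD2 DiffI m_closed)
qed

text \<open>With \<open>t\<close> also \<open>t \<otimes> a\<close> is a reflection, hence an involution, and inverting it swaps the factors.\<close>
lemma reflection_conj:
  assumes t: "t \<in> carrier G - A" and a: "a \<in> A"
  shows "t \<otimes> a = inv a \<otimes> t"
  using reflection_inv[OF reflection_mult_A[OF t a]] reflection_inv[OF t] t a
  by (metis A_closed(1) DiffD1 inv_mult_group)

text \<open>Conjugation by a reflection is a homomorphism and equals inversion, which forces commutativity.\<close>
lemma A_commute:
  assumes a: "a \<in> A" and b: "b \<in> A"
  shows "a \<otimes> b = b \<otimes> a"
proof -
  obtain t where t: "t \<in> carrier G - A"
    using reflection_exists by blast
  have "inv (a \<otimes> b) \<otimes> t = t \<otimes> a \<otimes> b"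
    using t a b reflection_conj[of t "a \<otimes> b"] by (simp add: m_assoc)
  also have "\<dots> = inv a \<otimes> (t \<otimes> b)"
    using t a b reflection_conj[of t a] by (simp add: m_assoc)
  also have "\<dots> = inv (b \<otimes> a) \<otimes> t"
    using t a b reflection_conj[of t b] by (simp add: m_assoc inv_mult_group)
  finally have "inv (a \<otimes> b) = inv (b \<otimes> a)"
    using t a b by simp
  then show ?thesis
    using a b inv_inj by (simp add: inj_on_def)
qed

lemma A_square_eq_one:
  assumes "a \<in> A" "a \<otimes> a = \<one>"
  shows "a = \<one>"
  using assms cube[of a] by simp

text \<open>
  Since all elements have order at most three, this is the cyclic subgroup generated by \<open>x\<close>.
  The same expression serves rotations and reflections: for a reflection it collapses to a set of
  two elements.
\<close>
definition cyc :: "'a \<Rightarrow> 'a set" where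
  "cyc x = {\<one>, x, inv x}"

lemma cyc_reflection: "t \<in> carrier G - A \<Longrightarrow> cyc t = {\<one>, t}"
  by (auto simp: cyc_def reflection_inv)

lemma cyc_subset_A: "a \<in> A \<Longrightarrow> cyc a \<subseteq> A"
  by (auto simp: cyc_def)

lemma square_cases:
  assumes x: "x \<in> carrier G"
  shows "x \<otimes> x = \<one> \<or> x \<otimes> x = inv x"
proof (cases "x \<in> A")
  case True
  then show ?thesis
    using cube[OF True] x inv_equality[of "x \<otimes> x" x] by auto
qed (use x reflection_square in auto)

lemma subgroup_cyc:
  assumes x: "x \<in> carrier G"
  shows "subgroup (cyc x) G"
proof (rule subgroupI)
  show "a \<otimes> b \<in> cyc x" if "a \<in> cyc x" "b \<in> cyc x" for a b
  proof -
    have "inv x \<otimes> inv x = \<one> \<or> inv x \<otimes> inv x = x"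
      using square_cases[OF x] x inv_mult_group[of x x] by auto
    then show ?thesis
      using that square_cases[OF x] x by (auto simp: cyc_def)
  qed
qed (use x in \<open>auto simp: cyc_def\<close>)

lemma range_int_pow_eq_cyc:
  assumes x: "x \<in> carrier G"
  shows "range (\<lambda>n::int. x [^] n) = cyc x"
proof
  show "range (\<lambda>n::int. x [^] n) \<subseteq> cyc x"
    using subgroup_int_pow_closed[OF subgroup_cyc[OF x], of x] by (auto simp: cyc_def)
  have "x [^] (0::int) = \<one>" "x [^] (1::int) = x" "x [^] (-1::int) = inv x"
    using x by (simp_all add: int_pow_neg)
  then show "cyc x \<subseteq> range (\<lambda>n::int. x [^] n)"
    unfolding cyc_def by (blast intro: range_eqI[OF sym])
qed

lemma cyclic_subgroups_eq_cyc:
  assumes "subgroup H G"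
  shows "cyclic_subgroups (G\<lparr>carrier := H\<rparr>) = cyc ` H"
  unfolding cyclic_subgroups_of_subgroup[OF assms]
  by (rule image_cong) (use range_int_pow_eq_cyc subgroup.mem_carrier[OF assms] in auto)

lemma normal_cyc_A:
  assumes a: "a \<in> A"
  shows "cyc a \<lhd> G"
proof -
  have "g \<otimes> h \<otimes> inv g \<in> cyc a" if g: "g \<in> carrier G" and h: "h \<in> cyc a" for g h
  proof -
    have hA: "h \<in> A" and "inv h \<in> cyc a"
      using h a by (auto simp: cyc_def)
    moreover have "g \<otimes> h \<otimes> inv g = (if g \<in> A then h else inv h)"
    proof (cases "g \<in> A")
      case True
      then show ?thesis
        using g hA A_commute[of g h] by (simp add: m_assoc)
    next
      case False
      then show ?thesis
        using g hA reflection_conj[of g h] by (simp add: m_assoc)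
    qed
    ultimately show ?thesis
      using h by simp
  qed
  then show ?thesis
    using subgroup_cyc[of a] a by (simp add: normal_inv_iff)
qed

text \<open>
  The only failures of permutability come from two distinct reflections \<open>x\<close> and \<open>y\<close>. If
  \<open>{1, x}\<close> and \<open>{1, y}\<close> permute, then \<open>x \<otimes> y \<in> {1, x, y, y \<otimes> x}\<close>, and as \<open>x \<otimes> y\<close> lies in \<open>A\<close>
  it equals 1 or \<open>y \<otimes> x\<close>. Either way \<open>x \<otimes> y\<close> is its own inverse, hence trivial because \<open>A\<close> has
  odd order.
\<close>
lemma cyc_permute_iff:
  assumes x: "x \<in> carrier G" and y: "y \<in> carrier G"
  shows "cyc x <#> cyc y = cyc y <#> cyc x \<longleftrightarrow> x \<in> A \<or> y \<in> A \<or> x = y"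
proof (cases "x \<in> A \<or> y \<in> A")
  case True
  then show ?thesis
    using commut_normal[OF subgroup_cyc[OF x] normal_cyc_A[of y]]
      commut_normal[OF subgroup_cyc[OF y] normal_cyc_A[of x]] by auto
next
  case False
  then have xr: "x \<in> carrier G - A" and yr: "y \<in> carrier G - A"
    using x y by auto
  have "x = y" if eq: "cyc x <#> cyc y = cyc y <#> cyc x"
  proof -
    have xyA: "x \<otimes> y \<in> A"
      using reflections_mult[OF xr yr] .
    have "x \<otimes> y \<in> cyc x <#> cyc y"
      by (auto simp: cyc_def set_mult_def)
    then have "x \<otimes> y \<in> {\<one>, y} <#> {\<one>, x}"
      unfolding eq by (simp only: cyc_reflection[OF xr] cyc_reflection[OF yr])
    then obtain h g where "h \<in> {\<one>, y}" "g \<in> {\<one>, x}" "x \<otimes> y = h \<otimes> g"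
      unfolding set_mult_def by blast
    then have "x \<otimes> y \<in> {\<one>, x, y, y \<otimes> x}"
      using x y by (elim insertE emptyE) simp_all
    then have "x \<otimes> y = \<one> \<or> x \<otimes> y = y \<otimes> x"
      using xyA xr yr by auto
    moreover have "inv (x \<otimes> y) = y \<otimes> x"
      using x y inv_mult_group reflection_inv[OF xr] reflection_inv[OF yr] by simp
    ultimately have "x \<otimes> y \<otimes> (x \<otimes> y) = \<one>"
      using x y by (metis l_one m_closed one_closed r_inv)
    then have "x \<otimes> y = \<one>"
      using A_square_eq_one[OF xyA] by blast
    then show ?thesis
      using x y inv_equality reflection_inv[OF yr] by metis
  qed
  with False show ?thesis
    by auto
qed

lemma cyc_reflection_eqD:
  assumes "x \<in> carrier G - A" "y \<in> carrier G" "cyc x = cyc y"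
  shows "x = y"
proof -
  have "x \<in> cyc y"
    using assms by (auto simp: cyc_def)
  then have "y \<notin> A"
    using assms cyc_subset_A[of y] by blast
  then show ?thesis
    using assms cyc_reflection[of x] cyc_reflection[of y] by (auto simp: doubleton_eq_iff)
qed

text \<open>Each nontrivial cyclic subgroup of \<open>B\<close> has exactly the two generators \<open>a\<close> and \<open>inv a\<close>.\<close>
lemma card_cyc_image_A:
  assumes B: "subgroup B G" "B \<subseteq> A"
  shows "2 * card (cyc ` B) = card B + 1"
proof -
  let ?B = "B - {\<one>}"
  have fin: "finite B"
    using B finite_carrier subgroup.subset finite_subset by metis
  have one: "\<one> \<in> B"
    using B subgroup.one_closed by blast
  have fibre: "card {b \<in> ?B. cyc b = K} = 2" if K: "K \<in> cyc ` ?B" for K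
  proof -
    obtain a where a: "a \<in> B" "a \<noteq> \<one>" "K = cyc a"
      using K by auto
    have aA: "a \<in> A"
      using a B by auto
    have inva: "inv a \<in> B" "inv a \<noteq> \<one>"
      using a aA B subgroup.m_inv_closed by (auto simp: inv_eq_1_iff)
    have "inv a \<noteq> a"
      using A_square_eq_one[OF aA] a aA by (metis A_closed(1) r_inv)
    moreover have "{b \<in> ?B. cyc b = K} = {a, inv a}"
      using a aA inva by (auto simp: cyc_def)
    ultimately show ?thesis
      by simp
  qed
  have "card ?B = (\<Sum>K\<in>cyc ` ?B. card {b \<in> ?B. cyc b = K})"
    using sum.image_gen[of ?B "\<lambda>_. 1::nat" cyc] fin by simp
  also have "\<dots> = 2 * card (cyc ` ?B)"
    using fibre by simp
  finally have "card ?B = 2 * card (cyc ` ?B)" .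
  moreover have "cyc ` B = insert (cyc \<one>) (cyc ` ?B)"
    using one by auto
  moreover have "cyc \<one> \<notin> cyc ` ?B"
    by (auto simp: cyc_def)
  moreover have "card B = Suc (card ?B)"
    by (rule card.remove[OF fin one])
  ultimately show ?thesis
    using fin by simp
qed

text \<open>Multiplication by a reflection of \<open>H\<close> exchanges the rotations and the reflections of \<open>H\<close>.\<close>
lemma card_reflections:
  assumes H: "subgroup H G" and "\<not> H \<subseteq> A"
  shows "card (H - A) = card (H \<inter> A)"
proof -
  obtain t where t: "t \<in> H" "t \<in> carrier G - A"
    using assms subgroup.subset by blast
  have "bij_betw (\<lambda>a. t \<otimes> a) (H \<inter> A) (H - A)"
  proof (rule bij_betw_byWitness[where f' = "\<lambda>a. t \<otimes> a"])
    have tt: "t \<otimes> (t \<otimes> a) = a" if "a \<in> carrier G" for a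
      using t that reflection_square by (simp add: m_assoc[symmetric])
    note HG = subgroup.mem_carrier[OF H]
    show "\<forall>a\<in>H \<inter> A. t \<otimes> (t \<otimes> a) = a" "\<forall>a\<in>H - A. t \<otimes> (t \<otimes> a) = a"
      using tt HG by simp_all
    show "(\<lambda>a. t \<otimes> a) ` (H \<inter> A) \<subseteq> H - A"
      using reflection_mult_A[OF t(2)] subgroup.m_closed[OF H t(1)] by auto
    show "(\<lambda>a. t \<otimes> a) ` (H - A) \<subseteq> H \<inter> A"
      using reflections_mult[OF t(2)] subgroup.m_closed[OF H t(1)] HG by auto
  qed
  then show ?thesis
    by (simp add: bij_betw_same_card)
qed

lemma card_cyc_image:
  assumes H: "subgroup H G" and HA: "\<not> H \<subseteq> A"
  shows "2 * card (cyc ` H) = 3 * card (H \<inter> A) + 1"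
proof -
  have fin: "finite H"
    using H finite_carrier subgroup.subset finite_subset by metis
  have HC: "H \<subseteq> carrier G"
    using H by (rule subgroup.subset)
  have inj: "inj_on cyc (H - A)"
    using cyc_reflection_eqD HC by (auto simp: inj_on_def)
  have disj: "cyc ` (H \<inter> A) \<inter> cyc ` (H - A) = {}"
  proof -
    have "cyc x \<noteq> cyc y" if "x \<in> H - A" "y \<in> H \<inter> A" for x y
      using that cyc_reflection_eqD[of x y] HC by auto
    then show ?thesis
      by blast
  qed
  have "cyc ` H = cyc ` (H \<inter> A) \<union> cyc ` (H - A)"
    by auto
  then have "card (cyc ` H) = card (cyc ` (H \<inter> A)) + card (H - A)"
    using disj fin inj by (simp add: card_Un_disjoint card_image)
  moreover have "2 * card (cyc ` (H \<inter> A)) = card (H \<inter> A) + 1"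
    using card_cyc_image_A subgroups_Inter_pair[OF H subgroup_A] by auto
  ultimately show ?thesis
    using card_reflections[OF H HA] by simp
qed

text \<open>
  The pairs of cyclic subgroups that do not permute correspond bijectively to the pairs of
  distinct reflections, one from \<open>H\<close> and one from \<open>G\<close>, because a reflection is determined by the
  subgroup that it generates.
\<close>
lemma csd_eq:
  assumes H: "subgroup H G"
  shows "csd H G = 1 - real (card (H - A)) * (real (card A) - 1) /
           (real (card (cyc ` H)) * real (card (cyc ` carrier G)))"
proof -
  have HC: "H \<subseteq> carrier G"
    using H by (rule subgroup.subset)
  have finH: "finite H"
    using HC finite_carrier finite_subset by blast
  have cH: "cyclic_subgroups (G\<lparr>carrier := H\<rparr>) = cyc ` H"
    using cyclic_subgroups_eq_cyc[OF H] .
  have cG: "cyclic_subgroups G = cyc ` carrier G"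
    using cyclic_subgroups_eq_cyc[OF subgroup_self] by simp
  let ?R = "carrier G - A"
  \<comment> \<open>pairs of elements whose cyclic subgroups do not permute\<close>
  let ?bad = "(SIGMA x:H - A. ?R - {x})"
  let ?pair = "\<lambda>(x, y). (cyc x, cyc y)"
  have notsub: "\<not> carrier G \<subseteq> A"
    using reflection_exists by auto
  have cardR: "card ?R = card A"
    using card_reflections[OF subgroup_self notsub] subgroup.subset[OF subgroup_A]
    by (simp add: Int_absorb1)
  have pairs: "{(H1, G1). (H1, G1) \<in> cyc ` H \<times> cyc ` carrier G \<and> H1 <#> G1 = G1 <#> H1} =
      cyc ` H \<times> cyc ` carrier G - ?pair ` ?bad" (is "?L = ?W - _")
  proof -
    have "(cyc x, cyc y) \<in> ?pair ` ?bad \<longleftrightarrow> x \<notin> A \<and> y \<notin> A \<and> x \<noteq> y"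
      if "x \<in> H" "y \<in> carrier G" for x y
    proof
      assume "(cyc x, cyc y) \<in> ?pair ` ?bad"
      then obtain x' y' where "x' \<in> H - A" "y' \<in> ?R" "x' \<noteq> y'" "cyc x' = cyc x" "cyc y' = cyc y"
        by auto
      moreover have "x' = x" "y' = y"
        using calculation cyc_reflection_eqD that HC by blast+
      ultimately show "x \<notin> A \<and> y \<notin> A \<and> x \<noteq> y"
        by auto
    qed (use that in force)
    note bad = this
    show ?thesis
    proof (rule Set.set_eqI)
      fix p
      show "p \<in> ?L \<longleftrightarrow> p \<in> ?W - ?pair ` ?bad"
      proof (cases "p \<in> ?W")
        case True
        then obtain x y where p: "p = (cyc x, cyc y)" and xy: "x \<in> H" "y \<in> carrier G"
          by blast
        have "p \<in> ?L \<longleftrightarrow> cyc x <#> cyc y = cyc y <#> cyc x"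
          using True by (simp add: p)
        also have "\<dots> \<longleftrightarrow> x \<in> A \<or> y \<in> A \<or> x = y"
          using cyc_permute_iff[of x y] xy HC by (simp add: subsetD)
        also have "\<dots> \<longleftrightarrow> p \<in> ?W - ?pair ` ?bad"
          using bad[OF xy] True unfolding p by blast
        finally show ?thesis .
      next
        case False
        then show ?thesis
          by auto
      qed
    qed
  qed
  have inj: "inj_on ?pair ?bad"
    using cyc_reflection_eqD subsetD[OF HC] by (auto simp: inj_on_def)
  have sub: "?pair ` ?bad \<subseteq> ?W"
    by auto
  have "card (?R - {x}) = card A - 1" if "x \<in> H - A" for x
    using that HC cardR finite_carrier by (simp add: subset_iff)
  then have bad: "card (?pair ` ?bad) = card (H - A) * (card A - 1)"
    using inj finH finite_carrier by (simp add: card_image)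
  have finW: "finite ?W"
    using finH finite_carrier by simp
  have le: "card (H - A) * (card A - 1) \<le> card (cyc ` H) * card (cyc ` carrier G)"
    using card_mono[OF finW sub] bad by (simp add: card_cartesian_product)
  have "card ?L = card (cyc ` H) * card (cyc ` carrier G) - card (H - A) * (card A - 1)"
    unfolding pairs using card_Diff_subset[OF finite_subset[OF sub finW] sub] bad
    by (simp add: card_cartesian_product)
  then have L: "real (card ?L) = real (card (cyc ` H)) * real (card (cyc ` carrier G)) -
      real (card (H - A)) * (real (card A) - 1)"
    using le card_A by (simp add: of_nat_diff)
  have "cyc ` H \<noteq> {}" "cyc ` carrier G \<noteq> {}"
    using subgroup.one_closed[OF H] by auto
  then have "card (cyc ` H) \<noteq> 0" "card (cyc ` carrier G) \<noteq> 0"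
    using finH finite_carrier by auto
  then show ?thesis
    unfolding csd_def cH cG L by (simp add: field_simps)
qed

text \<open>The degree of a subgroup that contains a reflection and meets \<open>A\<close> in \<open>3\<^sup>i\<close> elements.\<close>
definition csd_value :: "nat \<Rightarrow> real" where
  "csd_value i = 1 - 4 * 3 ^ i * (3 ^ k - 1) / ((3 * 3 ^ i + 1) * (3 * 3 ^ k + 1))"

lemma csd_rotations:
  assumes "subgroup H G" "H \<subseteq> A"
  shows "csd H G = 1"
proof -
  have "card (H - A) = 0"
    using assms by (simp add: Diff_eq_empty_iff[THEN iffD2])
  then show ?thesis
    using csd_eq[OF assms(1)] by simp
qed

lemma csd_dihedral:
  assumes H: "subgroup H G" "\<not> H \<subseteq> A" and i: "card (H \<inter> A) = 3 ^ i"
  shows "csd H G = csd_value i"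
proof -
  have notsub: "\<not> carrier G \<subseteq> A"
    using reflection_exists by auto
  have "2 * card (cyc ` H) = 3 * 3 ^ i + 1"
    using card_cyc_image[OF H] i by simp
  then have 1: "real (card (cyc ` H)) = (3 * 3 ^ i + 1) / 2"
    by (simp add: eq_divide_eq flip: of_nat_eq_iff[where 'a=real])
  have "2 * card (cyc ` carrier G) = 3 * 3 ^ k + 1"
    using card_cyc_image[OF subgroup_self notsub] card_A subgroup.subset[OF subgroup_A]
    by (simp add: Int_absorb1)
  then have 2: "real (card (cyc ` carrier G)) = (3 * 3 ^ k + 1) / 2"
    by (simp add: eq_divide_eq flip: of_nat_eq_iff[where 'a=real])
  have "real (card (H - A)) = 3 ^ i" "real (card A) = 3 ^ k"
    using card_reflections[OF H] i card_A by simp_all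
  then show ?thesis
    unfolding csd_eq[OF H(1)] csd_value_def 1 2 by simp
qed

lemma card_Int_A_power:
  assumes H: "subgroup H G"
  obtains i where "i \<le> k" "card (H \<inter> A) = 3 ^ i"
proof -
  interpret A: group "G\<lparr>carrier := A\<rparr>"
    using subgroup_A by (rule subgroup_imp_group)
  have order_A: "order (G\<lparr>carrier := A\<rparr>) = 3 ^ k"
    by (simp add: order_def card_A)
  have "subgroup (H \<inter> A) (G\<lparr>carrier := A\<rparr>)"
    using subgroup_incl[OF subgroups_Inter_pair[OF H subgroup_A] subgroup_A] by simp
  then have "card (H \<inter> A) dvd 3 ^ k"
    using A.lagrange[of "H \<inter> A"] card_A by (metis dvd_triv_right order_A)
  moreover have "prime (3::nat)"
    by simp
  ultimately show ?thesis
    using that by (auto simp: divides_primepow_nat)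
qed

text \<open>
  Sylow's theorem provides a subgroup \<open>B\<close> of \<open>A\<close> of order \<open>3\<^sup>i\<close>; a reflection \<open>t\<close> normalizes it,
  so \<open>B \<union> t B\<close> is a subgroup.
\<close>
lemma dihedral_subgroup_exists:
  assumes i: "i \<le> k"
  obtains H where "subgroup H G" "\<not> H \<subseteq> A" "card (H \<inter> A) = 3 ^ i"
proof -
  interpret A: group "G\<lparr>carrier := A\<rparr>"
    using subgroup_A by (rule subgroup_imp_group)
  have "order (G\<lparr>carrier := A\<rparr>) = 3 ^ i * 3 ^ (k - i)"
    using card_A i by (simp add: order_def flip: power_add)
  then obtain B where B: "subgroup B (G\<lparr>carrier := A\<rparr>)" "card B = 3 ^ i"
    using sylow_thm[of 3 "G\<lparr>carrier := A\<rparr>" i "3 ^ (k - i)"] A.group_axioms finite_carrier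
      subgroup.subset[OF subgroup_A] finite_subset by auto
  have BG: "subgroup B G" and BA: "B \<subseteq> A"
    using incl_subgroup[OF subgroup_A B(1)] subgroup.subset[OF B(1)] by auto
  obtain t where t: "t \<in> carrier G - A"
    using reflection_exists by blast
  let ?H = "B \<union> (\<lambda>b. t \<otimes> b) ` B"
  have tB: "t \<otimes> b \<in> carrier G - A" if "b \<in> B" for b
    using reflection_mult_A[OF t] that BA by auto
  have Bc: "b \<in> carrier G" if "b \<in> B" for b
    using that BG subgroup.mem_carrier by metis
  have swap: "b \<otimes> t = t \<otimes> inv b" if "b \<in> B" for b
    using reflection_conj[OF t, of "inv b"] that BA Bc by auto
  note closed = subgroup.m_closed[OF BG] subgroup.m_inv_closed[OF BG]
  have "subgroup ?H G"
  proof (rule subgroupI)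
    show "?H \<subseteq> carrier G"
      using Bc tB by auto
    show "?H \<noteq> {}"
      using subgroup.one_closed[OF BG] by auto
    show "inv h \<in> ?H" if "h \<in> ?H" for h
      using that closed reflection_inv tB by auto
    show "g \<otimes> h \<in> ?H" if "g \<in> ?H" "h \<in> ?H" for g h
    proof -
      have 1: "b \<otimes> (t \<otimes> c) = t \<otimes> (inv b \<otimes> c)" if "b \<in> B" "c \<in> B" for b c
        using swap[of b] that Bc t by (simp flip: m_assoc)
      have 2: "t \<otimes> b \<otimes> c = t \<otimes> (b \<otimes> c)" if "b \<in> B" "c \<in> B" for b c
        using that Bc t by (simp add: m_assoc)
      have 3: "t \<otimes> b \<otimes> (t \<otimes> c) = inv b \<otimes> c" if "b \<in> B" "c \<in> B" for b c
      proof -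
        have "t \<otimes> b \<otimes> (t \<otimes> c) = t \<otimes> t \<otimes> (inv b \<otimes> c)"
          using that Bc t 1[of b c] by (simp add: m_assoc)
        then show ?thesis
          using that Bc t reflection_square by simp
      qed
      show ?thesis
        using that closed by (auto simp: 1 2 3)
    qed
  qed
  moreover have "\<not> ?H \<subseteq> A"
    using tB subgroup.one_closed[OF BG] by blast
  moreover have "?H \<inter> A = B"
    using tB BA by blast
  ultimately show ?thesis
    using that B by auto
qed

lemma csd_values:
  "{csd H G | H. H \<in> subgroup_lattice G} = insert 1 (csd_value ` {..k})"
proof (intro equalityI subsetI)
  fix v assume "v \<in> {csd H G | H. H \<in> subgroup_lattice G}"
  then obtain H where H: "subgroup H G" "v = csd H G"
    by (auto simp: subgroup_lattice_def)
  obtain i where "i \<le> k" "card (H \<inter> A) = 3 ^ i"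
    using card_Int_A_power[OF H(1)] .
  then show "v \<in> insert 1 (csd_value ` {..k})"
    using csd_rotations[OF H(1)] csd_dihedral[OF H(1)] H(2) by auto
next
  fix v assume "v \<in> insert 1 (csd_value ` {..k})"
  then consider "v = 1" | i where "i \<le> k" "v = csd_value i"
    by auto
  then have "\<exists>H. subgroup H G \<and> v = csd H G"
  proof cases
    case 1
    then show ?thesis
      using csd_rotations[OF subgroup_A] subgroup_A by auto
  next
    case (2 i)
    then show ?thesis
      using dihedral_subgroup_exists[of i] csd_dihedral by metis
  qed
  then show "v \<in> {csd H G | H. H \<in> subgroup_lattice G}"
    by (auto simp: subgroup_lattice_def)
qed

text \<open>
  The dependence on \<open>e = 3\<^sup>i\<close> is through \<open>e / (3 e + 1)\<close>, which increases with \<open>e\<close>. The factor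
  \<open>3\<^sup>k - 1\<close> in front of it vanishes for \<open>k = 0\<close>.
\<close>
lemma csd_value_strict_antimono:
  assumes "0 < k" "i < j"
  shows "csd_value j < csd_value i"
proof -
  have "(3::real) ^ k > 1"
    using assms by simp
  then have pos: "4 * (3 ^ k - 1) / (3 * 3 ^ k + 1) > (0::real)"
    by (simp add: add_pos_pos)
  have frac: "csd_value l = 1 - 4 * (3 ^ k - 1) / (3 * 3 ^ k + 1) * (3 ^ l / (3 * 3 ^ l + 1))" for l
    by (simp add: csd_value_def mult_ac)
  have "(3::real) ^ i < 3 ^ j"
    using assms by simp
  then have "(3::real) ^ i / (3 * 3 ^ i + 1) < 3 ^ j / (3 * 3 ^ j + 1)"
    by (simp add: divide_simps add_pos_pos algebra_simps)
  then show ?thesis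
    unfolding frac by (intro diff_strict_left_mono mult_strict_left_mono pos)
qed

lemma csd_value_less_one: "0 < k \<Longrightarrow> csd_value i < 1"
  by (simp add: csd_value_def add_pos_pos)

theorem card_csd_values:
  "card {csd H G | H. H \<in> subgroup_lattice G} = (if k = 0 then 1 else k + 2)"
proof (cases "k = 0")
  case True
  have "csd_value i = 1" for i
    unfolding csd_value_def using True by simp
  then show ?thesis
    using True unfolding csd_values by (simp add: image_constant_conv)
next
  case False
  then have "inj_on csd_value {..k}"
    using csd_value_strict_antimono by (intro inj_onI) (metis less_irrefl linorder_neqE_nat not_gr0)
  moreover have "1 \<notin> csd_value ` {..k}"
  proof
    assume "1 \<in> csd_value ` {..k}"
    then obtain i where "csd_value i = 1"
      by auto
    then show False
      using csd_value_less_one[of i] \<open>k \<noteq> 0\<close> by simp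
  qed
  ultimately show ?thesis
    using False by (simp add: csd_values card_image)
qed

end

section \<open>Existence\<close>

text \<open>
  The semidirect product of \<open>A\<close> with the group of order two acting by inversion; the second
  component is \<open>True\<close> on the reflections.
\<close>
definition gen_dihedral :: "('a, 'b) monoid_scheme \<Rightarrow> ('a \<times> bool) monoid" where
  "gen_dihedral A = \<lparr>carrier = carrier A \<times> UNIV,
     monoid.mult = (\<lambda>(a, s) (b, t). (a \<otimes>\<^bsub>A\<^esub> (if s then inv\<^bsub>A\<^esub> b else b), s \<noteq> t)),
     one = (\<one>\<^bsub>A\<^esub>, False)\<rparr>"

lemma (in comm_group) group_gen_dihedral: "group (gen_dihedral G)"
proof (rule groupI)
  fix x assume "x \<in> carrier (gen_dihedral G)"
  then obtain a s where x: "x = (a, s)" "a \<in> carrier G"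
    by (auto simp: gen_dihedral_def)
  then have "(if s then a else inv a, s) \<in> carrier (gen_dihedral G)"
    "(if s then a else inv a, s) \<otimes>\<^bsub>gen_dihedral G\<^esub> x = \<one>\<^bsub>gen_dihedral G\<^esub>"
    by (auto simp: gen_dihedral_def)
  then show "\<exists>y\<in>carrier (gen_dihedral G). y \<otimes>\<^bsub>gen_dihedral G\<^esub> x = \<one>\<^bsub>gen_dihedral G\<^esub>"
    by blast
qed (auto simp: gen_dihedral_def m_assoc inv_mult m_closed)

lemma exponent3_dihedral_gen_dihedral:
  assumes "comm_group E" "card (carrier E) = 3 ^ k"
    and "\<And>a. a \<in> carrier E \<Longrightarrow> a \<otimes>\<^bsub>E\<^esub> a \<otimes>\<^bsub>E\<^esub> a = \<one>\<^bsub>E\<^esub>"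
  shows "exponent3_dihedral (gen_dihedral E) (carrier E \<times> {False}) k"
proof -
  interpret E: comm_group E by fact
  interpret D: group "gen_dihedral E" by (rule E.group_gen_dihedral)
  have fin: "finite (carrier E)"
    using assms(2) by (intro card_ge_0_finite) simp
  have "inv\<^bsub>gen_dihedral E\<^esub> (a, False) = (inv\<^bsub>E\<^esub> a, False)" if "a \<in> carrier E" for a
    using that by (intro D.inv_equality) (auto simp: gen_dihedral_def)
  then have "subgroup (carrier E \<times> {False}) (gen_dihedral E)"
    by (intro D.subgroupI) (auto simp: gen_dihedral_def)
  then show ?thesis
    using fin assms
    by (intro exponent3_dihedral.intro exponent3_dihedral_axioms.intro D.group_axioms)
      (auto simp: gen_dihedral_def card_cartesian_product)
qed

lemma exponent3_comm_group_exists: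
  obtains E :: "(nat \<Rightarrow> int) monoid" where "comm_group E" "card (carrier E) = 3 ^ k"
    "\<And>a. a \<in> carrier E \<Longrightarrow> a \<otimes>\<^bsub>E\<^esub> a \<otimes>\<^bsub>E\<^esub> a = \<one>\<^bsub>E\<^esub>"
proof
  let ?E = "product_group {..<k} (\<lambda>_. integer_mod_group 3)"
  interpret group ?E
    by simp
  show "comm_group ?E"
    by (rule group_comm_groupI) (auto simp: add.commute)
  show "card (carrier ?E) = 3 ^ k"
    by (simp add: card_PiE carrier_integer_mod_group)
  show "a \<otimes>\<^bsub>?E\<^esub> a \<otimes>\<^bsub>?E\<^esub> a = \<one>\<^bsub>?E\<^esub>" for a
    by (auto simp: fun_eq_iff restrict_def) presburger
qed

text \<open>The structure is transported along an injection of the finite carrier into the natural numbers.\<close>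
lemma (in exponent3_dihedral) exponent3_dihedral_nat:
  obtains N :: "nat monoid" and B where "exponent3_dihedral N B k"
proof -
  obtain f :: "'a \<Rightarrow> nat" where f: "inj_on f (carrier G)"
    using finite_imp_inj_to_nat_seg[OF finite_carrier] by blast
  define g where "g = the_inv_into (carrier G) f"
  have gf [simp]: "g (f x) = x" if "x \<in> carrier G" for x
    using f that by (simp add: g_def the_inv_into_f_f)
  define N :: "nat monoid" where
    "N = \<lparr>carrier = f ` carrier G, monoid.mult = (\<lambda>x y. f (g x \<otimes> g y)), one = f \<one>\<rparr>"
  interpret N: group N
  proof (rule groupI)
    fix x assume "x \<in> carrier N"
    then obtain y where "y \<in> carrier G" "x = f y"
      by (auto simp: N_def)
    then show "\<exists>z\<in>carrier N. z \<otimes>\<^bsub>N\<^esub> x = \<one>\<^bsub>N\<^esub>"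
      by (intro bexI[of _ "f (inv y)"]) (auto simp: N_def)
  qed (auto simp: N_def m_assoc)
  have mem: "f x \<in> f ` A \<longleftrightarrow> x \<in> A" if "x \<in> carrier G" for x
    using inj_on_image_mem_iff[OF f that] subgroup.subset[OF subgroup_A] by simp
  have "inv\<^bsub>N\<^esub> f a = f (inv a)" if "a \<in> A" for a
    using that by (intro N.inv_equality) (auto simp: N_def)
  moreover have "A \<noteq> {}"
    using A_closed(2) by blast
  ultimately have "subgroup (f ` A) N"
    by (intro N.subgroupI) (auto simp: N_def)
  moreover have "card (f ` A) = 3 ^ k"
    using card_A card_image inj_on_subset[OF f subgroup.subset[OF subgroup_A]] by metis
  moreover have "f ` carrier G - f ` A \<noteq> {}"
    using reflection_exists mem by blast
  ultimately have "exponent3_dihedral N (f ` A) k"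
    using finite_carrier
    by (intro exponent3_dihedral.intro exponent3_dihedral_axioms.intro N.group_axioms)
      (auto simp: N_def mem cube reflection_square reflections_mult)
  then show ?thesis
    by (rule that)
qed

theorem corollary3p4:
  fixes n :: nat
  assumes "0 < n" and "n \<noteq> 2"
  shows "\<exists>G :: nat monoid. group G \<and> finite (carrier G) \<and>
           card {csd H G | H. H \<in> subgroup_lattice G} = n"
proof -
  obtain E :: "(nat \<Rightarrow> int) monoid" where "comm_group E" "card (carrier E) = 3 ^ (n - 2)"
    "\<And>a. a \<in> carrier E \<Longrightarrow> a \<otimes>\<^bsub>E\<^esub> a \<otimes>\<^bsub>E\<^esub> a = \<one>\<^bsub>E\<^esub>"
    using exponent3_comm_group_exists by blast
  then have "exponent3_dihedral (gen_dihedral E) (carrier E \<times> {False}) (n - 2)"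
    by (rule exponent3_dihedral_gen_dihedral)
  then obtain G :: "nat monoid" and A where "exponent3_dihedral G A (n - 2)"
    by (rule exponent3_dihedral.exponent3_dihedral_nat)
  then interpret G: exponent3_dihedral G A "n - 2" .
  have "card {csd H G | H. H \<in> subgroup_lattice G} = n"
    using G.card_csd_values assms by (auto split: if_splits)
  then show ?thesis
    using G.group_axioms G.finite_carrier by blast
qed

end
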